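(* $gr^3_2(B_{13})=22$.
   Context: $K_n$ is the complete graph of order $n$. The book $B_n:=K_2+nK_1$ (graph join) is the graph on $n+2$ vertices consisting of an edge $xy$ (the spine) together with $n$ further, pairwise non-adjacent vertices (the pages), each adjacent to both $x$ and $y$. A $t$-coloring of $K_p$ is a map $f:E(K_p)\to\{1,\dots,t\}$, not assumed surjective. A Gallai $t$-coloring is a $t$-coloring with no rainbow triangle, i.e. there are no three vertices $x,y,z$ such that $f(xy),f(xz),f(yz)$ are pairwise distinct. For $1\le s<t$ and a graph $G$, the weakened Gallai-Ramsey number $gr^t_s(G)$ is the least $p\in\mathbb{N}$ such that every Gallai $t$-coloring of $K_p$ contains a (not necessarily induced) subgraph isomorphic to $G$ whose edges use at most $s$ colors. *)

theory Defs
  imports Main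
begin

record 'a ugraph =
  verts :: "'a set"
  edges :: "'a set set"

definition pairs :: "'a set \<Rightarrow> 'a set set" where
  "pairs V = {e. e \<subseteq> V \<and> card e = 2}"

definition simple_graph :: "'a ugraph \<Rightarrow> bool" where
  "simple_graph G \<longleftrightarrow> edges G \<subseteq> pairs (verts G)"

definition complete_graph :: "nat \<Rightarrow> nat ugraph" where
  "complete_graph n = \<lparr>verts = {..<n}, edges = pairs {..<n}\<rparr>"

(* The disjoint union n K_1 of n copies of K_1. *)
definition edgeless_graph :: "nat \<Rightarrow> nat ugraph" where
  "edgeless_graph n = \<lparr>verts = {..<n}, edges = {}\<rparr>"

definition graph_join :: "'a ugraph \<Rightarrow> 'b ugraph \<Rightarrow> ('a + 'b) ugraph" where
  "graph_join G H =
    \<lparr>verts = verts G <+> verts H,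
     edges = (\<lambda>e. Inl ` e) ` edges G \<union> (\<lambda>e. Inr ` e) ` edges H
             \<union> {{Inl x, Inr y} | x y. x \<in> verts G \<and> y \<in> verts H}\<rparr>"

definition book :: "nat \<Rightarrow> (nat + nat) ugraph" where
  "book n = graph_join (complete_graph 2) (edgeless_graph n)"

definition subgraph :: "'a ugraph \<Rightarrow> 'a ugraph \<Rightarrow> bool" where
  "subgraph H G \<longleftrightarrow> simple_graph H \<and> verts H \<subseteq> verts G \<and> edges H \<subseteq> edges G"

definition isomorphic :: "'a ugraph \<Rightarrow> 'b ugraph \<Rightarrow> bool" where
  "isomorphic G H \<longleftrightarrow>
    (\<exists>\<phi>. bij_betw \<phi> (verts G) (verts H) \<and> (\<lambda>e. \<phi> ` e) ` edges G = edges H)"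

(* A colouring is a total function on vertex sets; only its values on edges matter. *)
definition coloring :: "nat \<Rightarrow> 'a ugraph \<Rightarrow> ('a set \<Rightarrow> nat) \<Rightarrow> bool" where
  "coloring t G f \<longleftrightarrow> (\<forall>e\<in>edges G. f e \<in> {1..t})"

definition rainbow_triangle :: "'a ugraph \<Rightarrow> ('a set \<Rightarrow> nat) \<Rightarrow> 'a \<Rightarrow> 'a \<Rightarrow> 'a \<Rightarrow> bool" where
  "rainbow_triangle G f x y z \<longleftrightarrow>
    {x, y} \<in> edges G \<and> {x, z} \<in> edges G \<and> {y, z} \<in> edges G \<and>
    f {x, y} \<noteq> f {x, z} \<and> f {x, y} \<noteq> f {y, z} \<and> f {x, z} \<noteq> f {y, z}"

definition gallai_coloring :: "nat \<Rightarrow> 'a ugraph \<Rightarrow> ('a set \<Rightarrow> nat) \<Rightarrow> bool" where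
  "gallai_coloring t G f \<longleftrightarrow> coloring t G f \<and> \<not> (\<exists>x y z. rainbow_triangle G f x y z)"

(* gr t s G is the number with upper index t and lower index s, intended for 1 \<le> s < t. *)
definition gr :: "nat \<Rightarrow> nat \<Rightarrow> 'a ugraph \<Rightarrow> nat" where
  "gr t s G =
    (LEAST p. \<forall>f. gallai_coloring t (complete_graph p) f \<longrightarrow>
       (\<exists>H. subgraph H (complete_graph p) \<and> isomorphic G H \<and> card (f ` edges H) \<le> s))"

end

theory Submission
  imports Defs "HOL-Library.Disjoint_Sets"
begin

text \<open>
  In a Gallai 3-colouring the triangles over an edge \<open>xy\<close> that avoid a colour \<open>e\<close> different from the
  colour of \<open>xy\<close> form a 2-coloured book. Hence a colouring of \<open>K\<^sub>n\<close> has no 2-coloured \<open>B\<^sub>m\<close> iff it is wide: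
  for every colour \<open>e\<close>, two vertices not joined by \<open>e\<close> have together at least \<open>n - m - 1\<close> neighbours in the
  colour \<open>e\<close>. For \<open>n = 22\<close>, \<open>m = 13\<close> this number is 8.

  Some colour \<open>e\<close> is disconnected, and any two of its components are joined in one single colour. Two
  vertices in different components have disjoint \<open>e\<close>-neighbourhoods inside these components, so any two
  components have together at least 10 vertices and there are at most four components. If there are
  four, either one of them is joined to all the rest in one colour, or each one is joined to exactly
  one of the others in some colour, and counting neighbours in that colour needs more than 22
  vertices. With two or three components one of them is joined to all the rest in one colour. In such a
  monochromatic cut the smaller side has at most 11 vertices; it cannot have two or more since
  \<open>R(B\<^sub>2, B\<^sub>2) \<le> 10\<close>, so it is a single vertex, and the same analysis of the other 21 vertices, where
  now the two remaining colours have minimum degree 8, gives a contradiction.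
\<close>

section \<open>Components of a disconnected colour\<close>

text \<open>A binary function stands for the colouring of edge sets, so that triangles and
  neighbourhoods are easy to write. Its values on the diagonal are arbitrary, whence the guards
  \<open>x \<noteq> y\<close> below.\<close>

locale symmetric_coloring =
  fixes c :: "'a \<Rightarrow> 'a \<Rightarrow> nat"
  assumes sym: "c x y = c y x"
begin

definition gallai :: "'a set \<Rightarrow> bool" where
  "gallai V \<longleftrightarrow> (\<forall>x\<in>V. \<forall>y\<in>V. x \<noteq> y \<longrightarrow> c x y \<in> {1,2,3}) \<and>
    (\<forall>x\<in>V. \<forall>y\<in>V. \<forall>z\<in>V. x \<noteq> y \<longrightarrow> x \<noteq> z \<longrightarrow> y \<noteq> z \<longrightarrow>
      c x y = c x z \<or> c x y = c y z \<or> c x z = c y z)"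

definition reach :: "nat \<Rightarrow> 'a set \<Rightarrow> ('a \<times> 'a) set" where
  "reach e V = {(x, y). x \<in> V \<and> y \<in> V \<and> x \<noteq> y \<and> c x y = e}\<^sup>*"

definition nbrs :: "'a set \<Rightarrow> nat \<Rightarrow> 'a \<Rightarrow> 'a set" where
  "nbrs V e x = {z \<in> V. z \<noteq> x \<and> c x z = e}"

text \<open>For an edge \<open>x y\<close> outside colour \<open>e\<close>, the union consists of
  the other vertices that cannot be pages of a book on the spine \<open>x y\<close> avoiding
  \<open>e\<close>.\<close>

definition wide :: "'a set \<Rightarrow> nat \<Rightarrow> nat \<Rightarrow> bool" where
  "wide V e n \<longleftrightarrow> (\<forall>x\<in>V. \<forall>y\<in>V. x \<noteq> y \<longrightarrow> c x y \<noteq> e \<longrightarrow> n \<le> card (nbrs V e x \<union> nbrs V e y))"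

definition cut :: "'a set \<Rightarrow> nat \<Rightarrow> 'a set \<Rightarrow> bool" where
  "cut V k A \<longleftrightarrow> A \<noteq> {} \<and> A \<subset> V \<and> (\<forall>x\<in>A. \<forall>y\<in>V - A. c x y = k)"

text \<open>Meant for the components of colour \<open>e\<close>, but it records only what the
  counting uses: \<open>e\<close> stays inside the blocks, and any two blocks are joined in one
  colour.\<close>

definition gallai_partition :: "nat \<Rightarrow> 'a set \<Rightarrow> 'a set set \<Rightarrow> bool" where
  "gallai_partition e V P \<longleftrightarrow> partition_on V P \<and>
    (\<forall>A\<in>P. \<forall>B\<in>P. A \<noteq> B \<longrightarrow> (\<exists>k\<in>{1,2,3} - {e}. \<forall>x\<in>A. \<forall>y\<in>B. c x y = k))"

lemma gallai_subset: "gallai V \<Longrightarrow> W \<subseteq> V \<Longrightarrow> gallai W"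
  unfolding gallai_def by (meson subsetD)

lemma gallai_color: "gallai V \<Longrightarrow> x \<in> V \<Longrightarrow> y \<in> V \<Longrightarrow> x \<noteq> y \<Longrightarrow> c x y \<in> {1,2,3}"
  unfolding gallai_def by blast

lemma gallai_triangle:
  "gallai V \<Longrightarrow> x \<in> V \<Longrightarrow> y \<in> V \<Longrightarrow> z \<in> V \<Longrightarrow> x \<noteq> y \<Longrightarrow> x \<noteq> z \<Longrightarrow> y \<noteq> z \<Longrightarrow>
    c x y = c x z \<or> c x y = c y z \<or> c x z = c y z"
  unfolding gallai_def by blast

lemma wideD:
  "wide V e n \<Longrightarrow> x \<in> V \<Longrightarrow> y \<in> V \<Longrightarrow> x \<noteq> y \<Longrightarrow> c x y \<noteq> e \<Longrightarrow>
    n \<le> card (nbrs V e x \<union> nbrs V e y)"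
  unfolding wide_def by blast

section \<open>Reachability in one colour\<close>

lemma reach_refl [simp]: "(x, x) \<in> reach e V"
  by (simp add: reach_def)

lemma reach_sym: "(x, y) \<in> reach e V \<Longrightarrow> (y, x) \<in> reach e V"
  unfolding reach_def
  by (rule symD[OF sym_rtrancl]) (auto intro!: symI simp: sym)

lemma reach_trans: "(x, y) \<in> reach e V \<Longrightarrow> (y, z) \<in> reach e V \<Longrightarrow> (x, z) \<in> reach e V"
  unfolding reach_def by (rule rtrancl_trans)

lemma reach_edge: "x \<in> V \<Longrightarrow> y \<in> V \<Longrightarrow> c x y = e \<Longrightarrow> (x, y) \<in> reach e V"
  unfolding reach_def by (cases "x = y") (auto intro: r_into_rtrancl)

text \<open>Along an edge \<open>u w\<close> of colour \<open>e\<close> on the path, neither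
  \<open>u y\<close> nor \<open>w y\<close> has colour \<open>e\<close>, since \<open>y\<close> is
  in another component. As the triangle is not rainbow, these two colours agree.\<close>

lemma reach_color:
  assumes "gallai V" "(x, x') \<in> reach e V" "x \<in> V" "y \<in> V" "(x, y) \<notin> reach e V"
  shows "c x y = c x' y"
  using assms(2) unfolding reach_def
proof (induction rule: rtrancl_induct)
  case (step u w)
  have xu: "(x, u) \<in> reach e V"
    using step.hyps(1) by (simp add: reach_def)
  have uw: "u \<in> V" "w \<in> V" "u \<noteq> w" "c u w = e"
    using step.hyps(2) by auto
  have xw: "(x, w) \<in> reach e V"
    using reach_trans[OF xu reach_edge] uw by blast
  have "c u y \<noteq> e" "c w y \<noteq> e" "u \<noteq> y" "w \<noteq> y"
    using assms(4,5) reach_trans[OF xu reach_edge] reach_trans[OF xw reach_edge] uw xu xw by auto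
  then show ?case
    using gallai_triangle[OF assms(1) uw(1,2) assms(4)] uw step.IH by metis
qed simp

lemma reach_color2:
  assumes "gallai V" "(x, x') \<in> reach e V" "(y, y') \<in> reach e V"
    "x \<in> V" "y \<in> V" "x' \<in> V" "(x, y) \<notin> reach e V"
  shows "c x y = c x' y'"
proof -
  have "c x y = c x' y"
    using reach_color[OF assms(1,2,4,5,7)] .
  also have "\<dots> = c x' y'"
    using reach_color[OF assms(1,3,5,6)] assms(2,7) reach_trans reach_sym sym by metis
  finally show ?thesis .
qed

text \<open>Remove a vertex \<open>v\<close>; some colour \<open>e\<close> is disconnected on the rest. If it becomes connected, \<open>v\<close> sends
  colour \<open>e\<close> to every component, so a vertex joined to \<open>v\<close> by a colour \<open>a \<noteq> e\<close> forces the colour \<open>a\<close>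
  between its own component and all others. Hence \<open>v\<close> cannot meet both colours other than \<open>e\<close>.\<close>

lemma gallai_disconnected:
  assumes "finite V" "gallai V" "2 \<le> card V"
  shows "\<exists>e\<in>{1,2,3}. \<exists>x\<in>V. \<exists>y\<in>V. (x, y) \<notin> reach e V"
  using assms
proof (induction rule: finite_induct)
  case (insert v V)
  have gV: "gallai V"
    using gallai_subset[OF insert.prems(1)] by blast
  show ?case
  proof (rule ccontr)
    assume "\<not> ?case"
    then have conn: "(x, y) \<in> reach e (insert v V)"
      if "e \<in> {1,2,3}" "x \<in> insert v V" "y \<in> insert v V" for e x y
      using that by blast
    have "V \<noteq> {}"
      using insert.prems(2) by auto
    then obtain v' where v': "v' \<in> V"
      by blast
    \<comment> \<open>The first edge of a path in colour \<open>a\<close> from \<open>v\<close> to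
      another vertex.\<close>
    have nbr: "\<exists>y\<in>V. c v y = a" if "a \<in> {1,2,3}" for a
    proof -
      have "(v, v') \<in> reach a (insert v V)" "v \<noteq> v'"
        using conn that v' insert.hyps(2) by auto
      then show ?thesis
        unfolding reach_def by (auto elim: converse_rtranclE)
    qed
    have "card V \<noteq> 1"
    proof
      assume "card V = 1"
      then obtain w where "V = {w}"
        by (auto simp: card_1_singleton_iff)
      then show False
        using nbr[of 1] nbr[of 2] by auto
    qed
    then have "2 \<le> card V"
      using insert by auto
    then obtain e x0 y0 where e: "e \<in> {1,2,3}" and
      x0: "x0 \<in> V" "y0 \<in> V" "(x0, y0) \<notin> reach e V"
      using insert.IH[OF gV] by blast
    \<comment> \<open>A path in colour \<open>e\<close> from \<open>z\<close> to \<open>v\<close>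
      reaches \<open>v\<close> along an edge of colour \<open>e\<close> from the component of
      \<open>z\<close>.\<close>
    have rep: "\<exists>w\<in>V. (z, w) \<in> reach e V \<and> c v w = e" if z: "z \<in> V" for z
    proof (rule ccontr)
      assume no: "\<not> ?thesis"
      have "(z, v) \<in> reach e (insert v V)"
        using conn e z by blast
      then have "(z, v) \<in> reach e V \<and> v \<in> V"
        unfolding reach_def[of e "insert v V"]
      proof (induction rule: rtrancl_induct)
        case base
        show ?case using z by simp
      next
        case (step u w)
        then have "w \<noteq> v"
          using no sym by auto
        then show ?case
          using step reach_trans[of z u e V w] reach_edge[of u V w e] by auto
      qed
      then show False
        using insert.hyps(2) by blast
    qed
    obtain a b where ab: "a \<in> {1,2,3}" "b \<in> {1,2,3}" "a \<noteq> b" "a \<noteq> e" "b \<noteq> e"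
      using that[of 1 2] that[of 1 3] that[of 2 3] e by auto
    have same: "c y w = k"
      if "y \<in> V" "w \<in> V" "c v y = k" "k \<noteq> e" "c v w = e" "(y, w) \<notin> reach e V" for y w k
    proof -
      have "c y w \<noteq> e" "y \<noteq> w" "v \<noteq> y" "v \<noteq> w"
        using that reach_edge[of y V w e] insert.hyps(2) by auto
      then show ?thesis
        using gallai_triangle[OF insert.prems(1), of v y w] that by auto
    qed
    obtain y y' where y: "y \<in> V" "c v y = a" "y' \<in> V" "c v y' = b"
      using nbr[OF ab(1)] nbr[OF ab(2)] by auto
    obtain z where z: "z \<in> V" "(y, z) \<notin> reach e V"
      using x0 reach_trans[OF reach_sym, of y x0 e V y0] by auto
    obtain w where w: "w \<in> V" "(z, w) \<in> reach e V" "c v w = e"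
      using rep z by blast
    have yw: "(y, w) \<notin> reach e V"
      using z w reach_trans reach_sym by metis
    show False
    proof (cases "(y, y') \<in> reach e V")
      \<comment> \<open>If \<open>y\<close> and \<open>y'\<close> are in one component, its colour
        towards \<open>w\<close> would be both \<open>a\<close> and \<open>b\<close>.\<close>
      case True
      then have "(y', w) \<notin> reach e V"
        using yw reach_trans by metis
      then show False
        using same[of y w a] same[of y' w b] reach_color[OF gV True y(1) w(1) yw] y w yw ab by simp
    next
      \<comment> \<open>Otherwise \<open>y u'\<close> has colour \<open>a\<close> and
        \<open>y' u\<close> has colour \<open>b\<close>, although both pairs join the same two
        components.\<close>
      case False
      obtain u where u: "u \<in> V" "(y, u) \<in> reach e V" "c v u = e"
        using rep y by blast
      obtain u' where u': "u' \<in> V" "(y', u') \<in> reach e V" "c v u' = e"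
        using rep y by blast
      have n: "(y, u') \<notin> reach e V" "(y', u) \<notin> reach e V"
        using False u u' reach_trans reach_sym by metis+
      have "c y u' = c u y'"
        using reach_color2[OF gV u(2) reach_sym[OF u'(2)] _ _ _ n(1)] y u u' by blast
      then show False
        using same[of y u' a] same[of y' u b] y u u' n ab sym by metis
    qed
  qed
qed simp

text \<open>The blocks are the components of the colour that \<open>gallai_disconnected\<close>
  provides; \<open>reach_color2\<close> makes the edges between any two of them
  monochromatic.\<close>

lemma gallai_partition_exists:
  assumes "finite V" "gallai V" "2 \<le> card V"
  obtains e P where "e \<in> {1,2,3}" "gallai_partition e V P" "2 \<le> card P" "finite P"
proof -
  obtain e x0 y0 where e: "e \<in> {1,2,3}" and
    x0: "x0 \<in> V" "y0 \<in> V" "(x0, y0) \<notin> reach e V"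
    using gallai_disconnected[OF assms] by blast
  define K where "K x = {y \<in> V. (x, y) \<in> reach e V}" for x
  have K: "K x = K y" if "(x, y) \<in> reach e V" for x y
    using that reach_trans reach_sym unfolding K_def by blast
  have self: "x \<in> K x" if "x \<in> V" for x
    using that by (simp add: K_def)
  have part: "partition_on V (K ` V)"
  proof (rule partition_onI)
    show "\<Union> (K ` V) = V"
      using self by (auto simp: K_def)
    show "disjnt p q" if "p \<in> K ` V" "q \<in> K ` V" "p \<noteq> q" for p q
    proof (rule ccontr)
      assume "\<not> disjnt p q"
      then obtain u where u: "u \<in> p" "u \<in> q"
        by (auto simp: disjnt_def)
      obtain s t where st: "p = K s" "q = K t"
        using \<open>p \<in> K ` V\<close> \<open>q \<in> K ` V\<close> by blast
      then have "(s, u) \<in> reach e V" "(t, u) \<in> reach e V"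
        using u by (auto simp: K_def)
      then show False
        using K st \<open>p \<noteq> q\<close> by metis
    qed
    show "{} \<notin> K ` V"
      using self by auto
  qed
  have cross: "\<exists>k\<in>{1,2,3} - {e}. \<forall>x\<in>K u. \<forall>y\<in>K w. c x y = k"
    if "u \<in> V" "w \<in> V" "K u \<noteq> K w" for u w
  proof (intro bexI[of _ "c u w"] ballI)
    have n: "(u, w) \<notin> reach e V"
      using K that by blast
    then show "c u w \<in> {1,2,3} - {e}"
      using gallai_color[OF assms(2), of u w] reach_edge[of u V w e] that by auto
    show "c x y = c u w" if "x \<in> K u" "y \<in> K w" for x y
      using that reach_color2[OF assms(2) _ _ \<open>u \<in> V\<close> \<open>w \<in> V\<close> _ n, of x y]
      by (auto simp: K_def)
  qed
  have "gallai_partition e V (K ` V)"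
    unfolding gallai_partition_def
    by (intro conjI part ballI impI, elim imageE, hypsubst, rule cross)
  moreover have "2 \<le> card (K ` V)"
  proof -
    have "y0 \<in> K y0" "y0 \<notin> K x0"
      using x0 by (simp_all add: K_def)
    then have "card {K x0, K y0} = 2"
      by (intro card_2_iff[THEN iffD2]) blast
    then show ?thesis
      using card_mono[of "K ` V" "{K x0, K y0}"] x0 assms(1) by simp
  qed
  ultimately show thesis
    using that e assms(1) by blast
qed

section \<open>Blocks of a Gallai partition and monochromatic cuts\<close>

lemma gallai_partition_color:
  "gallai_partition e V P \<Longrightarrow> A \<in> P \<Longrightarrow> B \<in> P \<Longrightarrow> A \<noteq> B \<Longrightarrow>
    \<exists>k\<in>{1,2,3} - {e}. \<forall>x\<in>A. \<forall>y\<in>B. c x y = k"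
  unfolding gallai_partition_def by blast

lemma gallai_partition_nbrs:
  assumes "gallai_partition e V P" "A \<in> P" "x \<in> A"
  shows "nbrs V e x \<subseteq> A - {x}"
proof
  fix y assume y: "y \<in> nbrs V e x"
  then obtain B where B: "B \<in> P" "y \<in> B"
    using assms(1) unfolding gallai_partition_def partition_on_def nbrs_def by blast
  show "y \<in> A - {x}"
  proof (cases "A = B")
    case False
    then show ?thesis
      using gallai_partition_color[OF assms(1,2) B(1)] B assms(3) y by (auto simp: nbrs_def)
  qed (use B y in \<open>auto simp: nbrs_def\<close>)
qed

lemma gallai_partition_card:
  assumes "gallai_partition e V P" "finite V" "Q \<subseteq> P"
  shows "(\<Sum>A\<in>Q. card A) \<le> card V"
proof -
  have P: "partition_on V P"
    using assms(1) by (simp add: gallai_partition_def)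
  then have U: "\<Union>P = V" and "finite P"
    using finite_elements[OF assms(2)] partition_onD1[of V P] by auto
  have disj: "pairwise disjnt Q"
    using P assms(3) by (meson partition_on_def pairwise_subset)
  have fin: "finite A" if "A \<in> P" for A
    using U assms(2) that by (metis Union_upper finite_subset)
  have "(\<Sum>A\<in>Q. card A) = card (\<Union>Q)"
    using assms(3) fin by (intro card_Union_disjoint[OF disj, symmetric]) auto
  then show ?thesis
    using assms(2,3) card_mono[of V "\<Union>Q"] Union_mono[of Q P] U by auto
qed

lemma block_notin:
  assumes "gallai_partition e V P" "A \<in> P" "B \<in> P" "A \<noteq> B" "x \<in> A"
  shows "x \<notin> B"
  using assms unfolding gallai_partition_def partition_on_def disjoint_def by blast

text \<open>The second block \<open>B\<close> makes \<open>A\<close> a proper subset of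
  \<open>V\<close>.\<close>

lemma block_cut:
  assumes P: "gallai_partition e V P" and A: "A \<in> P" and "B \<in> P" "B \<noteq> A"
    and k: "\<And>B. B \<in> P - {A} \<Longrightarrow> \<forall>x\<in>A. \<forall>y\<in>B. c x y = k"
  shows "cut V k A"
proof -
  have U: "\<Union>P = V" "{} \<notin> P"
    using P by (auto simp: gallai_partition_def partition_on_def)
  obtain b where b: "b \<in> B"
    using U \<open>B \<in> P\<close> by (metis ex_in_conv)
  then have "b \<notin> A" "b \<in> V"
    using block_notin[OF P \<open>B \<in> P\<close> A \<open>B \<noteq> A\<close>] U \<open>B \<in> P\<close> by auto
  moreover have "A \<subseteq> V" "A \<noteq> {}"
    using U A by auto
  moreover have "c x y = k" if "x \<in> A" "y \<in> V - A" for x y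
    using that k U by blast
  ultimately show ?thesis
    unfolding cut_def by blast
qed

lemma cut_compl: "cut V k A \<Longrightarrow> cut V k (V - A)"
  unfolding cut_def by (auto simp: double_diff) (metis DiffI sym)

text \<open>The complement of a side is again a side, and one of the two has at most half of the
  vertices.\<close>

lemma small_cut:
  assumes "cut V k A" "finite V"
  obtains B where "cut V k B" "2 * card B \<le> card V"
proof -
  have "card V = card A + card (V - A)"
    using assms card_Diff_subset[of A V] card_mono[of V A] finite_subset[of A V]
    by (auto simp: cut_def)
  then show thesis
    using that[OF assms(1)] that[OF cut_compl[OF assms(1)]] by linarith
qed


text \<open>Vertices in different blocks are not joined in \<open>e\<close>, so wideness applies to
  them. Their \<open>e\<close>-neighbourhoods stay in their own blocks and omit \<open>x\<close> and
  \<open>y\<close>, which gives the summand 2.\<close>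

lemma card_two_blocks:
  assumes "gallai_partition e V P" "finite V" "A \<in> P" "B \<in> P" "A \<noteq> B"
    and wide: "wide V e n"
    and "x \<in> A" "y \<in> B"
  shows "n \<le> card (nbrs V e x) + card (nbrs V e y)" and "n + 2 \<le> card A + card B"
proof -
  have sub: "A \<subseteq> V" "B \<subseteq> V"
    using assms(1,3,4) by (auto simp: gallai_partition_def partition_on_def)
  have "c x y \<noteq> e" "x \<noteq> y"
    using gallai_partition_color[OF assms(1,3,4,5)] block_notin[OF assms(1,3,4,5)] assms by auto
  then have "n \<le> card (nbrs V e x \<union> nbrs V e y)"
    using wideD[OF wide] assms(7,8) sub by blast
  then show 1: "n \<le> card (nbrs V e x) + card (nbrs V e y)"
    using card_Un_le le_trans by blast
  have "card (nbrs V e x) \<le> card (A - {x})" "card (nbrs V e y) \<le> card (B - {y})"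
    using gallai_partition_nbrs[OF assms(1)] assms(2,3,4,7,8) finite_subset[OF sub(1)]
      finite_subset[OF sub(2)] by (meson card_mono finite_Diff)+
  moreover have "card A > 0" "card B > 0"
    using assms sub finite_subset by (auto simp: card_gt_0_iff)
  ultimately show "n + 2 \<le> card A + card B"
    using 1 assms(7,8) by simp
qed

text \<open>Placing five blocks on a cycle and adding the bounds for its five consecutive pairs
  counts each block twice, so \<open>5 * n\<close> would be at most
  \<open>2 * card V\<close>.\<close>

lemma card_blocks_le_4:
  assumes "gallai_partition e V P" "finite V" "finite P"
    and n: "\<And>A B. A \<in> P \<Longrightarrow> B \<in> P \<Longrightarrow> A \<noteq> B \<Longrightarrow> n \<le> card A + card B"
    and "2 * card V < 5 * n"
  shows "card P \<le> 4"
proof (rule ccontr)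
  assume "\<not> ?thesis"
  then obtain Q where Q: "Q \<subseteq> P" "card Q = 5"
    using obtain_subset_with_card_n[of 5 P] by auto
  then obtain xs where "distinct xs" "set xs = Q" "length xs = 5"
    by (metis assms(3) distinct_card finite_distinct_list finite_subset)
  then obtain A B C D E where "Q = {A, B, C, D, E}" "distinct [A, B, C, D, E]"
    by (auto simp: numeral_eq_Suc length_Suc_conv)
  then have Q': "Q = {A, B, C, D, E}"
    and d: "A \<noteq> B" "A \<noteq> C" "A \<noteq> D" "A \<noteq> E" "B \<noteq> C" "B \<noteq> D" "B \<noteq> E" "C \<noteq> D" "C \<noteq> E" "D \<noteq> E"
    by simp_all
  have mem: "A \<in> P" "B \<in> P" "C \<in> P" "D \<in> P" "E \<in> P"
    using Q(1) unfolding Q' by simp_all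
  have "card A + card B + card C + card D + card E \<le> card V"
    using gallai_partition_card[OF assms(1,2) Q(1)] d unfolding Q' by simp
  moreover have "n \<le> card A + card B" "n \<le> card B + card C" "n \<le> card C + card D"
      "n \<le> card D + card E" "n \<le> card E + card A"
    using n[OF mem(1,2)] n[OF mem(2,3)] n[OF mem(3,4)] n[OF mem(4,5)] n[OF mem(5,1)] d
    by (simp_all add: d(4)[symmetric])
  ultimately show False
    using assms(5) by linarith
qed

lemma other_blocks:
  assumes P: "gallai_partition e V P" and "A \<in> P"
  obtains k where "\<And>B. B \<in> P - {A} \<Longrightarrow> k B \<in> {1,2,3} - {e}"
    and "\<And>B x y. B \<in> P - {A} \<Longrightarrow> x \<in> A \<Longrightarrow> y \<in> B \<Longrightarrow> c x y = k B"
proof -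
  have "\<forall>B\<in>P - {A}. \<exists>k. k \<in> {1,2,3} - {e} \<and> (\<forall>x\<in>A. \<forall>y\<in>B. c x y = k)"
    using gallai_partition_color[OF P \<open>A \<in> P\<close>] by blast
  then obtain k where "\<forall>B\<in>P - {A}. k B \<in> {1,2,3} - {e} \<and> (\<forall>x\<in>A. \<forall>y\<in>B. c x y = k B)"
    unfolding bchoice_iff by blast
  then show thesis
    using that by blast
qed

text \<open>Only two colours besides \<open>e\<close> can join \<open>A\<close> to the other three
  blocks. Either all three get the same one, which gives a cut, or one colour leads to a single
  block, the pivot \<open>B\<close>.\<close>

lemma cut_or_pivot:
  assumes "e \<in> {1,2,3}" and P: "gallai_partition e V P" and A: "A \<in> P" "card P = 4"
  shows "(\<exists>k\<in>{1,2,3}. cut V k A) \<or>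
    (\<exists>k\<in>{1,2,3} - {e}. \<exists>B\<in>P - {A}. \<forall>x\<in>A. \<forall>y\<in>V - A. c x y = k \<longrightarrow> y \<in> B)"
proof -
  obtain k where k: "\<And>B. B \<in> P - {A} \<Longrightarrow> k B \<in> {1,2,3} - {e}"
    "\<And>B x y. B \<in> P - {A} \<Longrightarrow> x \<in> A \<Longrightarrow> y \<in> B \<Longrightarrow> c x y = k B"
    using other_blocks[OF P A(1)] by blast
  have "card (P - {A}) = 3"
    using A by simp
  then obtain B C D where BCD: "P - {A} = {B, C, D}" "B \<noteq> C" "B \<noteq> D" "C \<noteq> D"
    by (auto simp: card_3_iff)
  then have mem: "B \<in> P - {A}" "C \<in> P - {A}" "D \<in> P - {A}"
    by blast+
  have U: "\<exists>X\<in>P - {A}. y \<in> X" if "y \<in> V - A" for y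
    using that P unfolding gallai_partition_def partition_on_def by blast
  have piv: ?thesis if eq: "P - {A} = {B', C', D'}" and ne: "k B' \<noteq> k C'" "k B' \<noteq> k D'"
    for B' C' D'
  proof -
    have "y \<in> B'" if "x \<in> A" "y \<in> V - A" "c x y = k B'" for x y
    proof -
      obtain X where X: "X \<in> P - {A}" "y \<in> X"
        using U \<open>y \<in> V - A\<close> by blast
      then have "k X = k B'"
        using k(2)[of X x y] that by simp
      moreover have "X \<in> {B', C', D'}"
        using X(1) eq by metis
      ultimately show ?thesis
        using X(2) ne by auto
    qed
    moreover have "B' \<in> P - {A}"
      unfolding eq by simp
    ultimately show ?thesis
      using k(1)[of B'] by blast
  qed
  consider "k B = k C" "k B = k D" | "k B \<noteq> k C" "k B \<noteq> k D"
    | "k C \<noteq> k B" "k C \<noteq> k D" | "k D \<noteq> k B" "k D \<noteq> k C"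
    using k(1)[of B] k(1)[of C] k(1)[of D] mem \<open>e \<in> {1,2,3}\<close> by auto
  then show ?thesis
  proof cases
    case 1
    have "cut V (k B) A"
    proof (rule block_cut[OF P A(1)])
      show "B \<in> P" "B \<noteq> A"
        using mem by blast+
      fix X assume X: "X \<in> P - {A}"
      then have "X \<in> {B, C, D}"
        using BCD(1) by metis
      then have "k X = k B"
        using 1 by auto
      then show "\<forall>x\<in>A. \<forall>y\<in>X. c x y = k B"
        using k(2)[OF X] by simp
    qed
    then show ?thesis
      using k(1)[of B] mem by blast
  next
    case 2
    then show ?thesis using piv[OF BCD(1)] by blast
  next
    case 3
    then show ?thesis using piv[of C B D] BCD(1) by (simp add: insert_commute)
  next
    case 4
    then show ?thesis using piv[of D B C] BCD(1) by (simp add: insert_commute)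
  qed
qed

text \<open>With three blocks, two of the three pairs share a colour since only two colours are
  available; the block common to these pairs is a side of a cut.\<close>

lemma cut_if_few_blocks:
  assumes "e \<in> {1,2,3}" and P: "gallai_partition e V P" and "2 \<le> card P" "card P \<le> 3"
  shows "\<exists>k\<in>{1,2,3}. \<exists>A. cut V k A"
proof (cases "card P = 2")
  case True
  then obtain A B where AB: "P = {A, B}" "A \<noteq> B"
    by (auto simp: card_2_iff)
  then obtain k where k: "k \<in> {1,2,3} - {e}" "\<forall>x\<in>A. \<forall>y\<in>B. c x y = k"
    using gallai_partition_color[OF P, of A B] by blast
  then have "cut V k A"
    using AB by (intro block_cut[OF P, of A B]) auto
  then show ?thesis
    using k by blast
next
  case False
  then have "card P = 3"
    using assms by simp
  then obtain A B C where ABC: "P = {A, B, C}" "A \<noteq> B" "A \<noteq> C" "B \<noteq> C"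
    by (auto simp: card_3_iff)
  obtain k where k: "k \<in> {1,2,3} - {e}" "\<forall>x\<in>A. \<forall>y\<in>B. c x y = k"
    using gallai_partition_color[OF P, of A B] ABC by blast
  obtain l where l: "l \<in> {1,2,3} - {e}" "\<forall>x\<in>A. \<forall>y\<in>C. c x y = l"
    using gallai_partition_color[OF P, of A C] ABC by blast
  obtain m where m: "m \<in> {1,2,3} - {e}" "\<forall>x\<in>B. \<forall>y\<in>C. c x y = m"
    using gallai_partition_color[OF P, of B C] ABC by blast
  have sw: "\<forall>x\<in>B. \<forall>y\<in>A. c x y = k" "\<forall>x\<in>C. \<forall>y\<in>A. c x y = l" "\<forall>x\<in>C. \<forall>y\<in>B. c x y = m"
    using k l m sym by metis+
  consider "k = l" | "k = m" | "l = m"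
    using k(1) l(1) m(1) \<open>e \<in> {1,2,3}\<close> by auto
  then show ?thesis
  proof cases
    case 1
    then have "cut V k A"
      using ABC k l by (intro block_cut[OF P, of A B]) auto
    then show ?thesis using k by blast
  next
    case 2
    then have "cut V k B"
      using ABC sw m by (intro block_cut[OF P, of B A]) auto
    then show ?thesis using k by blast
  next
    case 3
    then have "cut V l C"
      using ABC sw by (intro block_cut[OF P, of C A]) auto
    then show ?thesis using l by blast
  qed
qed

end

section \<open>Counting neighbours\<close>

text \<open>Five vertices have the same value \<open>b\<close> towards a fixed vertex. Among them
  the pairs of value \<open>b\<close> form a matching, which misses one of the five; that vertex
  lies on the spine of a book in the other value. In the conclusion \<open>x y\<close> is the spine
  and \<open>z\<close>, \<open>w\<close> are the pages.\<close>

lemma ramsey_book2: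
  fixes Q :: "'a \<Rightarrow> 'a \<Rightarrow> bool"
  assumes "finite A" "10 \<le> card A" and sym: "\<And>x y. Q x y = Q y x"
  obtains x y z w where "x \<in> A" "y \<in> A" "z \<in> A" "w \<in> A" "distinct [x, y, z, w]"
    "Q x z = Q x y" "Q y z = Q x y" "Q x w = Q x y" "Q y w = Q x y"
proof (rule ccontr)
  note book = that
  assume no: "\<not> thesis"
  obtain x where x: "x \<in> A"
    using assms by fastforce
  have no5: False if S: "S \<subseteq> A - {x}" "5 \<le> card S" "\<And>y. y \<in> S \<Longrightarrow> Q x y = b" for S b
  proof -
    \<comment> \<open>Two such vertices \<open>v\<close>, \<open>w\<close> would be the pages of a
      book with spine \<open>x u\<close>.\<close>
    have one: "\<not> (Q u v = b \<and> Q u w = b)"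
      if "u \<in> S" "v \<in> S" "w \<in> S" "distinct [u, v, w]" for u v w
      using no book[of x u v w] S that x by auto
    \<comment> \<open>By the matching property at least two of \<open>w1\<close>, \<open>w2\<close>,
      \<open>w3\<close> are joined to \<open>v\<close> in the other value, and they are pages for
      the spine \<open>u v\<close>.\<close>
    have free: False
      if "distinct [u, v, w1, w2, w3]" "set [u, v, w1, w2, w3] \<subseteq> S"
        "Q u v \<noteq> b" "Q u w1 \<noteq> b" "Q u w2 \<noteq> b" "Q u w3 \<noteq> b" for u v w1 w2 w3
    proof -
      have bk: "\<not> (Q v w \<noteq> b \<and> Q v w' \<noteq> b)"
        if "w \<in> {w1, w2, w3}" "w' \<in> {w1, w2, w3}" "w \<noteq> w'" for w w'
        using no book[of u v w w'] \<open>distinct [u, v, w1, w2, w3]\<close> \<open>set [u, v, w1, w2, w3] \<subseteq> S\<close>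
          S(1) \<open>Q u v \<noteq> b\<close> \<open>Q u w1 \<noteq> b\<close> \<open>Q u w2 \<noteq> b\<close> \<open>Q u w3 \<noteq> b\<close> that
        by auto
      show False
        using bk[of w1 w2] bk[of w1 w3] bk[of w2 w3] one[of v w1 w2] one[of v w1 w3] one[of v w2 w3]
          that(1,2) by auto
    qed
    \<comment> \<open>Three vertices cannot be perfectly matched, so one of \<open>w1\<close>,
      \<open>w2\<close>, \<open>w3\<close> has no partner at all.\<close>
    have matched: False
      if "distinct [u, v, w1, w2, w3]" "set [u, v, w1, w2, w3] \<subseteq> S" "Q u v = b" for u v w1 w2 w3
    proof -
      have "Q w u \<noteq> b \<and> Q w v \<noteq> b" if "w \<in> {w1, w2, w3}" for w
        using one[of u v w] one[of v u w] \<open>Q u v = b\<close> sym[of w] sym[of u v] that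
          \<open>distinct [u, v, w1, w2, w3]\<close> \<open>set [u, v, w1, w2, w3] \<subseteq> S\<close> by auto
      then show False
        using free[of w1 u v w2 w3] free[of w2 u v w1 w3] free[of w3 u v w1 w2]
          one[of w1 w2 w3] one[of w2 w1 w3] one[of w3 w1 w2] sym[of w1 w2] sym[of w1 w3] sym[of w2 w3]
          that(1,2) by auto
    qed
    obtain T where T: "T \<subseteq> S" "card T = 5"
      using obtain_subset_with_card_n[OF S(2)] by metis
    then obtain xs where "distinct xs" "set xs = T" "length xs = 5"
      by (metis card.infinite distinct_card finite_distinct_list zero_neq_numeral)
    with T obtain p q r s t where d: "distinct [p, q, r, s, t]" "set [p, q, r, s, t] \<subseteq> S"
      by (auto simp: numeral_eq_Suc length_Suc_conv)
    show False
      using free[OF d] matched[OF d] matched[of p r q s t] matched[of p s q r t]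
        matched[of p t q r s] d by auto
  qed
  have "A - {x} = {y \<in> A - {x}. Q x y} \<union> {y \<in> A - {x}. \<not> Q x y}"
    by blast
  then have "card (A - {x}) \<le> card {y \<in> A - {x}. Q x y} + card {y \<in> A - {x}. \<not> Q x y}"
    by (metis (lifting) card_Un_le)
  moreover have "9 \<le> card (A - {x})"
    using assms x by simp
  moreover have "\<not> 5 \<le> card {y \<in> A - {x}. Q x y}"
    by (intro notI no5[of "{y \<in> A - {x}. Q x y}" True]) auto
  moreover have "\<not> 5 \<le> card {y \<in> A - {x}. \<not> Q x y}"
    by (intro notI no5[of "{y \<in> A - {x}. \<not> Q x y}" False]) auto
  ultimately show False
    by linarith
qed

context symmetric_coloring
begin

section \<open>Small sides of monochromatic cuts\<close>

lemma finite_nbrs [simp]: "finite V \<Longrightarrow> finite (nbrs V e x)"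
  by (simp add: nbrs_def)

lemma other_colors:
  assumes "k \<in> {1,2,3::nat}"
  obtains q r where "q \<in> {1,2,3}" "r \<in> {1,2,3}" "q \<noteq> r" "q \<noteq> k" "r \<noteq> k"
proof -
  have "k = 1 \<or> k = 2 \<or> k = 3"
    using assms by auto
  then show thesis
  proof (elim disjE)
    assume "k = 1"
    then show thesis by (intro that[of 2 3]) auto
  next
    assume "k = 2"
    then show thesis by (intro that[of 1 3]) auto
  next
    assume "k = 3"
    then show thesis by (intro that[of 1 2]) auto
  qed
qed

lemma cut_nbrs:
  assumes "cut V k A" "x \<in> A" "q \<noteq> k"
  shows "nbrs V q x \<subseteq> A - {x}"
  using assms unfolding cut_def nbrs_def by blast

text \<open>For a colour \<open>q \<noteq> k\<close> all \<open>q\<close>-neighbours of vertices of \<open>A\<close> lie in \<open>A\<close>, so at most \<open>card A - 10 \<le> 1\<close> of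
  the remaining vertices of \<open>A\<close> avoid the colour \<open>q\<close> towards both ends of an edge not coloured \<open>q\<close>. Merging
  all colours other than one such \<open>q\<close> then gives a 2-colouring without a monochromatic \<open>B\<^sub>2\<close>.\<close>

lemma no_cut_of_medium_size:
  assumes "gallai V" "finite V" and cut: "cut V k A" and k: "k \<in> {1,2,3}"
    and A: "2 \<le> card A" "card A \<le> 11"
    and wide: "\<And>e. e \<in> {1,2,3} \<Longrightarrow> wide V e 8"
  shows False
proof -
  obtain q r where qr: "q \<in> {1,2,3}" "r \<in> {1,2,3}" "q \<noteq> r" "q \<noteq> k" "r \<noteq> k"
    using other_colors[OF k] by metis
  have AV: "A \<subseteq> V" and fA: "finite A"
    using cut assms(2) finite_subset by (auto simp: cut_def)
  \<comment> \<open>\<open>Z\<close> consists of \<open>x\<close>, \<open>y\<close> and further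
    vertices of \<open>A\<close> joined to neither of them in \<open>e\<close>. It misses both
    neighbourhoods, so 8 neighbours must fit into \<open>A - Z\<close>.\<close>
  have union: "nbrs V e x \<union> nbrs V e y \<subseteq> A - Z" "8 + card Z \<le> card A"
    if "x \<in> A" "y \<in> A" "x \<noteq> y" "c x y \<noteq> e" "e = q \<or> e = r" "x \<in> Z" "y \<in> Z"
      "\<And>z. z \<in> Z \<Longrightarrow> z \<in> A \<and> (z = x \<or> c x z \<noteq> e) \<and> (z = y \<or> c y z \<noteq> e)" for e x y Z
  proof -
    have "nbrs V e x \<subseteq> A - {x}" "nbrs V e y \<subseteq> A - {y}"
      using cut_nbrs[OF cut] that(1,2,5) qr by blast+
    then show sub: "nbrs V e x \<union> nbrs V e y \<subseteq> A - Z"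
      using that(3,4,6,7,8) sym[of x y] unfolding nbrs_def by blast
    have "8 \<le> card (nbrs V e x \<union> nbrs V e y)"
      using wideD[OF wide] that(1-5) AV qr by blast
    also have "\<dots> \<le> card (A - Z)"
      using sub fA by (intro card_mono) auto
    also have "\<dots> = card A - card Z"
      using that(8) fA by (intro card_Diff_subset) (auto intro: finite_subset)
    finally show "8 + card Z \<le> card A"
      by linarith
  qed
  obtain a b where ab: "a \<in> A" "b \<in> A" "a \<noteq> b"
    using A(1) by (metis card_le_Suc0_iff_eq fA not_less_eq_eq numeral_2_eq_2)
  then have "c a b \<noteq> q \<or> c a b \<noteq> r"
    using qr by auto
  then have "8 + card {a, b} \<le> card A"
  proof
    assume "c a b \<noteq> q"
    then show ?thesis
      using ab sym[of b a] by (intro union(2)[of a b q]) auto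
  next
    assume "c a b \<noteq> r"
    then show ?thesis
      using ab sym[of b a] by (intro union(2)[of a b r]) auto
  qed
  then have "10 \<le> card A"
    using ab by simp
  then obtain x y z w where xyzw: "x \<in> A" "y \<in> A" "z \<in> A" "w \<in> A" "distinct [x, y, z, w]"
    and mono: "(c x z = q) = (c x y = q)" "(c y z = q) = (c x y = q)"
      "(c x w = q) = (c x y = q)" "(c y w = q) = (c x y = q)"
    using ramsey_book2[OF fA, of "\<lambda>x y. c x y = q"] sym by metis
  \<comment> \<open>The four vertices of the book force \<open>card A\<close> to be at least 12. If
    the book has colour \<open>q\<close> it avoids \<open>r\<close>, otherwise it avoids
    \<open>q\<close>.\<close>
  have "8 + card {x, y, z, w} \<le> card A"
  proof (cases "c x y = q")
    case True
    then show ?thesis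
      using mono xyzw qr sym[of y x] by (intro union(2)[of x y r]) auto
  next
    case False
    then show ?thesis
      using mono xyzw sym[of y x] by (intro union(2)[of x y q]) auto
  qed
  then show False
    using A(2) xyzw(5) by simp
qed

section \<open>Neighbour counts with four blocks\<close>

text \<open>The two blocks other than \<open>A\<close> and \<open>D\<close> have together at least
  \<open>n\<close> vertices.\<close>

lemma four_blocks:
  assumes P: "gallai_partition e V P" and "finite V" "card P = 4" "A \<in> P" "D \<in> P" "A \<noteq> D"
    and n: "\<And>A B. A \<in> P \<Longrightarrow> B \<in> P \<Longrightarrow> A \<noteq> B \<Longrightarrow> n \<le> card A + card B"
  shows "card A + card D + n \<le> card V"
proof -
  have "finite P"
    using assms(3) by (metis card.infinite zero_neq_numeral)
  then have "card (P - {A, D}) = 2"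
    using assms by (simp add: card_Diff_subset)
  then obtain B C where BC: "P - {A, D} = {B, C}" "B \<noteq> C"
    by (auto simp: card_2_iff)
  then have *: "B \<in> P" "C \<in> P" "A \<noteq> B" "A \<noteq> C" "D \<noteq> B" "D \<noteq> C"
    by blast+
  have "(\<Sum>X\<in>{A, D, B, C}. card X) \<le> card V"
    using * assms(4,5) by (intro gallai_partition_card[OF P assms(2)]) auto
  then show ?thesis
    using * assms(6) BC(2) n[of B C] by simp
qed

lemma min_nbrs:
  assumes "finite A" "A \<noteq> {}"
  obtains x where "x \<in> A" "\<And>y. y \<in> A \<Longrightarrow> card (nbrs V e x) \<le> card (nbrs V e y)"
  using arg_min_if_finite[OF assms, of "\<lambda>x. card (nbrs V e x)"] that
  by (metis not_le_imp_less)

text \<open>Outside \<open>A\<close> the \<open>k\<close>-neighbours of \<open>x\<close> lie in the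
  pivot \<open>B\<close>; inside \<open>A\<close> they are among the vertices that are not
  \<open>e\<close>-neighbours, which the second claim counts.\<close>

lemma pivot_nbrs:
  assumes P: "gallai_partition e V P" and "finite V" "A \<in> P" "x \<in> A" "k \<noteq> e"
    and piv: "\<forall>x\<in>A. \<forall>y\<in>V - A. c x y = k \<longrightarrow> y \<in> B"
  shows "nbrs V k x \<subseteq> B \<union> (A - {x} - nbrs V e x)"
    and "card (A - {x} - nbrs V e x) + card (nbrs V e x) + 1 = card A"
proof -
  show "nbrs V k x \<subseteq> B \<union> (A - {x} - nbrs V e x)"
    using assms unfolding nbrs_def by blast
  have "A \<subseteq> V"
    using P assms(3) by (auto simp: gallai_partition_def partition_on_def)
  then have fA: "finite A"
    using assms(2) finite_subset by blast
  have "nbrs V e x \<subseteq> A - {x}"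
    using gallai_partition_nbrs[OF P assms(3,4)] .
  then have "card (A - {x} - nbrs V e x) + card (nbrs V e x) = card (A - {x})"
    using fA card_mono[of "A - {x}" "nbrs V e x"] assms(2)
    by (subst card_Diff_subset) (auto intro: finite_subset)
  moreover have "card (A - {x}) + 1 = card A"
    using card_Suc_Diff1[OF fA assms(4)] by simp
  ultimately show "card (A - {x} - nbrs V e x) + card (nbrs V e x) + 1 = card A"
    by linarith
qed

text \<open>From \<open>x\<close> the two colours other than \<open>k\<close> lead only into
  \<open>A\<close>, to disjoint sets of vertices.\<close>

lemma cut_two_colors:
  assumes "cut V k A" "finite V" "x \<in> A" "q \<noteq> k" "r \<noteq> k" "q \<noteq> r"
  shows "card (nbrs V q x) + card (nbrs V r x) + 1 \<le> card A"
proof -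
  have fA: "finite A"
    using assms(1,2) finite_subset by (auto simp: cut_def)
  have sub: "nbrs V q x \<union> nbrs V r x \<subseteq> A - {x}"
    using cut_nbrs[OF assms(1,3)] assms(4,5) by blast
  have "nbrs V q x \<inter> nbrs V r x = {}"
    using assms(6) by (auto simp: nbrs_def)
  then have "card (nbrs V q x) + card (nbrs V r x) = card (nbrs V q x \<union> nbrs V r x)"
    using assms(2) by (simp add: card_Un_disjoint)
  also have "\<dots> \<le> card (A - {x})"
    using sub fA by (intro card_mono) auto
  finally show ?thesis
    using card_Suc_Diff1[OF fA assms(3)] by simp
qed

text \<open>\<open>W\<close> is what remains of 22 vertices when one that is joined to all others in
  \<open>p\<close> is removed. That vertex supplied one common \<open>p\<close>-neighbour, hence 7
  instead of 8; it has no neighbours in another colour, hence the degree bound 8.\<close>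

lemma no_dominating_vertex:
  assumes W: "gallai W" "finite W" "card W = 21" and p: "p \<in> {1,2,3}" and wide: "wide W p 7"
    and deg: "\<And>x q. x \<in> W \<Longrightarrow> q \<in> {1,2,3} \<Longrightarrow> q \<noteq> p \<Longrightarrow> 8 \<le> card (nbrs W q x)"
  shows False
proof -
  have no_cut: "\<not> cut W k A" if k: "k \<in> {1,2,3}" for k A
  proof
    assume "cut W k A"
    then obtain B where "cut W k B" "2 * card B \<le> card W"
      using small_cut[OF _ W(2)] by blast
    then have B: "cut W k B" "card B \<le> 10"
      using W(3) by auto
    then obtain x where x: "x \<in> B" "B \<subseteq> W"
      by (auto simp: cut_def)
    show False
    proof (cases "k = p")
      \<comment> \<open>Both other colours stay in \<open>B\<close>, which would need 8 + 8 + 1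
        vertices instead of at most 10.\<close>
      case True
      obtain q r where "q \<in> {1,2,3}" "r \<in> {1,2,3}" "q \<noteq> r" "q \<noteq> p" "r \<noteq> p"
        using other_colors[OF p] by metis
      then show False
        using cut_two_colors[OF B(1) W(2) x(1), of q r] deg[of x q] deg[of x r] x B(2) True by auto
    next
      \<comment> \<open>The third colour \<open>s\<close> takes 8 of the at most 9 other vertices of
        \<open>B\<close> and leaves one for \<open>p\<close>. Two vertices joined in
        \<open>s\<close> then have at most 2 neighbours in \<open>p\<close>, not 7.\<close>
      case False
      obtain s where s: "s \<in> {1,2,3}" "s \<noteq> p" "s \<noteq> k"
        using other_colors[OF p] by metis
      have small: "card (nbrs W p u) \<le> 1" if "u \<in> B" for u
        using cut_two_colors[OF B(1) W(2) that, of s p] deg[of u s] s False that x(2) B(2) by auto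
      have "nbrs W s x \<noteq> {}"
        using deg[of x s] s x by auto
      then obtain y where y: "y \<in> nbrs W s x"
        by blast
      then have "y \<in> B" "x \<noteq> y" "c x y \<noteq> p"
        using cut_nbrs[OF B(1) x(1), of s] s by (auto simp: nbrs_def)
      then have "7 \<le> card (nbrs W p x) + card (nbrs W p y)"
        using wideD[OF wide, of x y] x card_Un_le[of "nbrs W p x" "nbrs W p y"] by fastforce
      then show False
        using small[OF x(1)] small[OF \<open>y \<in> B\<close>] by linarith
    qed
  qed
  obtain e P where e: "e \<in> {1,2,3}" and P: "gallai_partition e W P" "2 \<le> card P" "finite P"
    using gallai_partition_exists[OF W(2,1)] W(3) by auto
  then have many: "4 \<le> card P"
    using cut_if_few_blocks[OF e P(1,2)] no_cut by force
  have sub: "A \<subseteq> W" "A \<noteq> {}" if "A \<in> P" for A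
    using P(1) that by (auto simp: gallai_partition_def partition_on_def)
  show False
  proof (cases "e = p")
    \<comment> \<open>Every block has at least 9 vertices, and four such blocks exceed 21.\<close>
    case False
    have "9 \<le> card A" if "A \<in> P" for A
    proof -
      obtain x where x: "x \<in> A" "x \<in> W"
        using sub[OF \<open>A \<in> P\<close>] by blast
      have fA: "finite A"
        using sub(1)[OF that] W(2) finite_subset by blast
      have "8 \<le> card (nbrs W e x)"
        using deg[OF x(2) e False] .
      also have "\<dots> \<le> card (A - {x})"
        using gallai_partition_nbrs[OF P(1) that x(1)] fA by (intro card_mono) auto
      finally show ?thesis
        using card_Suc_Diff1[OF fA x(1)] by simp
    qed
    then have "of_nat (card P) * 9 \<le> (\<Sum>A\<in>P. card A)"
      by (intro sum_bounded_below) auto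
    then show False
      using gallai_partition_card[OF P(1) W(2) order_refl] W(3) many by simp
  next
    case True
    have two: "7 \<le> card (nbrs W p x) + card (nbrs W p y)" "9 \<le> card A + card B"
      if "A \<in> P" "B \<in> P" "A \<noteq> B" "x \<in> A" "y \<in> B" for A B x y
      using card_two_blocks[OF P(1) W(2) that(1-3) _ that(4,5), of 7] wide True by auto
    have pair: "9 \<le> card A + card B" if "A \<in> P" "B \<in> P" "A \<noteq> B" for A B
      using two(2)[OF that] sub that by blast
    have four: "card P = 4"
      using card_blocks_le_4[OF P(1) W(2) P(3), of 9] pair W(3) many by simp
    \<comment> \<open>Here \<open>card A + card D\<close> is at most 21 - 9 = 12, so 8 neighbours in
      the pivot colour \<open>k\<close> leave at most 12 - 1 - 8 = 3 in colour \<open>p\<close>. Two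
      blocks then yield 6 < 7.\<close>
    have le: "card (nbrs W p x) \<le> 3" if A: "A \<in> P" "x \<in> A" for A x
    proof -
      obtain k D where k: "k \<in> {1,2,3} - {p}" and D: "D \<in> P" "A \<noteq> D"
        and piv: "\<forall>x\<in>A. \<forall>y\<in>W - A. c x y = k \<longrightarrow> y \<in> D"
        using cut_or_pivot[OF e P(1) A(1) four] no_cut True by auto
      note nb = pivot_nbrs[OF P(1) W(2) A _ piv]
      have "finite A" "finite D"
        using sub A(1) D(1) W(2) finite_subset by blast+
      then have "card (nbrs W k x) \<le> card (D \<union> (A - {x} - nbrs W e x))"
        using nb(1) k True by (intro card_mono) auto
      also have "\<dots> \<le> card D + card (A - {x} - nbrs W e x)"
        by (rule card_Un_le)
      finally have "8 \<le> card D + card (A - {x} - nbrs W e x)"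
        using deg[of x k] k A sub by fastforce
      then show ?thesis
        using nb(2) k True four_blocks[OF P(1) W(2) four A(1) D pair] W(3) by simp
    qed
    obtain A B where AB: "A \<in> P" "B \<in> P" "A \<noteq> B"
      using card_le_Suc0_iff_eq[OF P(3)] many by auto
    obtain x y where xy: "x \<in> A" "y \<in> B"
      using sub AB by blast
    then show False
      using two(1)[OF AB xy] le[OF AB(1) xy(1)] le[OF AB(2) xy(2)] by linarith
  qed
qed

text \<open>Once cuts are excluded, each of the four blocks has a vertex whose doubled
  \<open>e\<close>-degree is at most the block size plus 2. These sum to at most 22 + 8 = 30,
  whereas two disjoint pairs of blocks require 2 * (8 + 8) = 32.\<close>

lemma no_wide_coloring_22:
  assumes V: "gallai V" "finite V" "card V = 22" and wide: "\<And>e. e \<in> {1,2,3} \<Longrightarrow> wide V e 8"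
  shows False
proof -
  have no_cut: "\<not> cut V k A" if k: "k \<in> {1,2,3}" for k A
  proof
    assume "cut V k A"
    then obtain B where B: "cut V k B" "2 * card B \<le> card V"
      using small_cut[OF _ V(2)] by metis
    have "card B = 1"
    proof -
      have "finite B" "B \<noteq> {}"
        using B(1) V(2) finite_subset by (auto simp: cut_def)
      then have "0 < card B"
        by (simp add: card_gt_0_iff)
      moreover have "\<not> 2 \<le> card B"
        using no_cut_of_medium_size[OF V(1,2) B(1) k _ _ wide] B(2) V(3) by auto
      ultimately show ?thesis
        by linarith
    qed
    then obtain v where v: "B = {v}"
      by (auto simp: card_1_singleton_iff)
    define W where "W = V - {v}"
    have vW: "c v x = k" "c x v = k" if "x \<in> W" for x
      using B(1) sym[of x v] that by (auto simp: cut_def v W_def)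
    have vV: "v \<in> V"
      using B(1) by (auto simp: cut_def v)
    show False
    proof (rule no_dominating_vertex[of W k])
      show "gallai W" "finite W" "card W = 21" "k \<in> {1,2,3}"
        using gallai_subset[OF V(1), of W] V(2,3) vV k by (auto simp: W_def)
      show "wide W k 7"
        unfolding wide_def
      proof (intro ballI impI)
        fix x y assume xy: "x \<in> W" "y \<in> W" "x \<noteq> y" "c x y \<noteq> k"
        have "8 \<le> card (nbrs V k x \<union> nbrs V k y)"
          using wideD[OF wide[OF k]] xy by (simp add: W_def)
        also have "\<dots> \<le> card (insert v (nbrs W k x \<union> nbrs W k y))"
          using V(2) by (intro card_mono) (auto simp: nbrs_def W_def)
        also have "\<dots> \<le> card (nbrs W k x \<union> nbrs W k y) + 1"
          using V(2) by (simp add: card_insert_if W_def)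
        finally show "7 \<le> card (nbrs W k x \<union> nbrs W k y)"
          by simp
      qed
      \<comment> \<open>All edges at \<open>v\<close> have colour \<open>k\<close>, so
        \<open>v\<close> contributes nothing in colour \<open>q\<close> and the 8 neighbours all
        belong to \<open>x\<close>.\<close>
      fix x q assume x: "x \<in> W" and q: "q \<in> {1,2,3}" "q \<noteq> k"
      have "8 \<le> card (nbrs V q v \<union> nbrs V q x)"
        using wideD[OF wide[OF q(1)] vV, of x] x vW q by (auto simp: W_def)
      also have "nbrs V q v \<union> nbrs V q x = nbrs W q x"
        using vW x q by (auto simp: nbrs_def W_def)
      finally show "8 \<le> card (nbrs W q x)" .
    qed
  qed
  obtain e P where e: "e \<in> {1,2,3}" and P: "gallai_partition e V P" "2 \<le> card P" "finite P"
    using gallai_partition_exists[OF V(2,1)] V(3) by auto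
  then have many: "4 \<le> card P"
    using cut_if_few_blocks[OF e P(1,2)] no_cut by force
  have sub: "A \<subseteq> V" "A \<noteq> {}" if "A \<in> P" for A
    using P(1) that by (auto simp: gallai_partition_def partition_on_def)
  have two: "8 \<le> card (nbrs V e x) + card (nbrs V e y)" "10 \<le> card A + card B"
    if "A \<in> P" "B \<in> P" "A \<noteq> B" "x \<in> A" "y \<in> B" for A B x y
    using card_two_blocks[OF P(1) V(2) that(1-3) _ that(4,5), of 8] wide[OF e] by auto
  have pair: "10 \<le> card A + card B" if "A \<in> P" "B \<in> P" "A \<noteq> B" for A B
    using two(2)[OF that] sub that by blast
  have four: "card P = 4"
    using card_blocks_le_4[OF P(1) V(2) P(3), of 10] pair V(3) many by simp
  have "\<exists>x\<in>A. 2 * card (nbrs V e x) \<le> card A + 2" if A: "A \<in> P" for A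
  proof -
    have fin: "finite A"
      using sub(1)[OF A] V(2) finite_subset by blast
    obtain x where x: "x \<in> A" and min: "\<And>y. y \<in> A \<Longrightarrow> card (nbrs V e x) \<le> card (nbrs V e y)"
      using min_nbrs[OF fin sub(2)[OF A]] by metis
    show ?thesis
    proof (cases "nbrs V e x = {}")
      case True
      then show ?thesis using x by (intro bexI[of _ x]) auto
    next
      case False
      then obtain y where y: "y \<in> A" "x \<noteq> y" "c x y = e"
        using gallai_partition_nbrs[OF P(1) A x] by (auto simp: nbrs_def)
      obtain k D where k: "k \<in> {1,2,3} - {e}" and D: "D \<in> P" "A \<noteq> D"
        and piv: "\<forall>x\<in>A. \<forall>y\<in>V - A. c x y = k \<longrightarrow> y \<in> D"
        using cut_or_pivot[OF e P(1) A four] no_cut by auto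
      have ke: "k \<noteq> e"
        using k by simp
      note nx = pivot_nbrs[OF P(1) V(2) A x ke piv] and ny = pivot_nbrs[OF P(1) V(2) A y(1) ke piv]
      have finD: "finite D"
        using sub(1)[OF D(1)] V(2) finite_subset by blast
      \<comment> \<open>The edge \<open>x y\<close> has colour \<open>e\<close>, so wideness in the
        pivot colour \<open>k\<close> applies. As \<open>card A + card D\<close> is at most 12, the
        \<open>e\<close>-degrees of \<open>x\<close> and \<open>y\<close> sum to at most
        \<open>card A + 2\<close>, and that of \<open>x\<close> is the smaller one.\<close>
      have "8 \<le> card (nbrs V k x \<union> nbrs V k y)"
        using wideD[OF wide, of k x y] k x y sub(1)[OF A] by auto
      also have "\<dots> \<le> card (D \<union> ((A - {x} - nbrs V e x) \<union> (A - {y} - nbrs V e y)))"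
        using nx(1) ny(1) fin finD by (intro card_mono) auto
      also have "\<dots> \<le> card D + (card (A - {x} - nbrs V e x) + card (A - {y} - nbrs V e y))"
        by (meson add_left_mono card_Un_le order_trans)
      finally show ?thesis
        using nx(2) ny(2) min[OF y(1)] four_blocks[OF P(1) V(2) four A D pair] V(3) x
        by (intro bexI[of _ x]) auto
    qed
  qed
  then obtain f where f: "\<And>A. A \<in> P \<Longrightarrow> f A \<in> A \<and> 2 * card (nbrs V e (f A)) \<le> card A + 2"
    by metis
  obtain xs where xs: "distinct xs" "set xs = P" "length xs = 4"
    by (metis P(3) four distinct_card finite_distinct_list)
  then obtain A B C D where "distinct [A, B, C, D]" "P = {A, B, C, D}"
    by (auto simp: numeral_eq_Suc length_Suc_conv)
  then have d: "A \<noteq> B" "A \<noteq> C" "A \<noteq> D" "B \<noteq> C" "B \<noteq> D" "C \<noteq> D"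
    and mem: "A \<in> P" "B \<in> P" "C \<in> P" "D \<in> P"
    and "(\<Sum>X\<in>P. card X) = card A + card B + card C + card D"
    by auto
  moreover have "8 \<le> card (nbrs V e (f A)) + card (nbrs V e (f B))"
      "8 \<le> card (nbrs V e (f C)) + card (nbrs V e (f D))"
    using two(1)[OF mem(1,2) d(1)] two(1)[OF mem(3,4) d(6)] f mem by blast+
  ultimately show False
    using f[OF mem(1)] f[OF mem(2)] f[OF mem(3)] f[OF mem(4)]
      gallai_partition_card[OF P(1) V(2) order_refl] V(3) by linarith
qed

end

section \<open>Books and the extremal colouring\<close>

lemma verts_book: "verts (book n) = {..<2} <+> {..<n}"
  by (simp add: book_def graph_join_def complete_graph_def edgeless_graph_def)

lemma edges_book:
  "edges (book n) = insert {Inl 0, Inl 1} {{Inl i, Inr j} | i j. i < 2 \<and> j < n}"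
proof -
  have "pairs {..<2} = {{0, 1 :: nat}}"
    by (auto simp: pairs_def card_2_iff doubleton_eq_iff less_2_cases_iff)
  then show ?thesis
    by (simp add: book_def graph_join_def complete_graph_def edgeless_graph_def)
qed

lemma lessThan_2_eq: "{..<2} = {0, 1 :: nat}"
  by auto

text \<open>Written with images so that applying a vertex map to all edges becomes a matter of
  rewriting.\<close>

lemma edges_book_set:
  "edges (book n) = insert {Inl 0, Inl 1} ((\<lambda>j. {Inl 0, Inr j}) ` {..<n} \<union> (\<lambda>j. {Inl 1, Inr j}) ` {..<n})"
  unfolding edges_book by (auto simp: less_2_cases_iff)

lemma isomorphic_bookI:
  assumes "x \<noteq> y" "x \<notin> Z" "y \<notin> Z" "finite Z" "card Z = n"
    and "verts H = insert x (insert y Z)"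
    and "edges H = insert {x, y} ((\<lambda>z. {x, z}) ` Z \<union> (\<lambda>z. {y, z}) ` Z)"
  shows "isomorphic (book n) H"
proof -
  obtain g where g: "bij_betw g {..<n} Z"
    using assms(4,5) by (metis card_lessThan finite_lessThan finite_same_card_bij)
  define h where "h = case_sum (\<lambda>i :: nat. if i = 0 then x else y) g"
  have gZ: "g ` {..<n} = Z" and inj: "inj_on g {..<n}"
    using g by (auto simp: bij_betw_def)
  have "inj_on h (verts (book n))"
    using assms(1-3) inj gZ
    unfolding verts_book h_def inj_on_def by (auto simp: less_2_cases_iff split: if_splits)
  moreover have "h ` verts (book n) = verts H"
  proof -
    have "h ` verts (book n) = h ` Inl ` {0, 1} \<union> h ` Inr ` {..<n}"
      unfolding verts_book Plus_def lessThan_2_eq by (rule image_Un)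
    also have "\<dots> = {x, y} \<union> g ` {..<n}"
      by (simp add: h_def image_image)
    finally show ?thesis
      unfolding gZ assms(6) by simp
  qed
  moreover have "(`) h ` edges (book n) = edges H"
    unfolding edges_book_set assms(7) gZ[symmetric] by (simp add: h_def image_Un image_image)
  ultimately show ?thesis
    unfolding isomorphic_def bij_betw_def by blast
qed

lemma isomorphic_bookD:
  assumes "isomorphic (book n) H"
  obtains x y Z where "x \<in> verts H" "y \<in> verts H" "x \<noteq> y" "Z \<subseteq> verts H - {x, y}"
    "finite Z" "card Z = n" "{x, y} \<in> edges H"
    "\<And>z. z \<in> Z \<Longrightarrow> {x, z} \<in> edges H \<and> {y, z} \<in> edges H"
proof -
  obtain h where inj: "inj_on h (verts (book n))" and V: "h ` verts (book n) = verts H"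
    and E: "(`) h ` edges (book n) = edges H"
    using assms by (auto simp: isomorphic_def bij_betw_def)
  have V': "Inl 0 \<in> verts (book n)" "Inl 1 \<in> verts (book n)"
    "\<And>j. j < n \<Longrightarrow> Inr j \<in> verts (book n)"
    by (auto simp: verts_book)
  have edge: "h ` e \<in> edges H" if "e \<in> edges (book n)" for e
    using that E by blast
  let ?Z = "h ` Inr ` {..<n}"
  show thesis
  proof
    show "h (Inl 0) \<in> verts H" "h (Inl 1) \<in> verts H"
      using V V' by blast+
    show "h (Inl 0) \<noteq> h (Inl 1)"
      using inj_onD[OF inj _ V'(1,2)] by auto
    show "?Z \<subseteq> verts H - {h (Inl 0), h (Inl 1)}"
      using V V' inj_on_eq_iff[OF inj] by fastforce
    show "card ?Z = n"
      using V'(3) by (subst card_image) (auto intro: inj_on_subset[OF inj] simp: card_image)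
    show "{h (Inl 0), h (Inl 1)} \<in> edges H"
      using edge[of "{Inl 0, Inl 1}"] by (simp add: edges_book)
    show "{h (Inl 0), z} \<in> edges H \<and> {h (Inl 1), z} \<in> edges H" if z: "z \<in> ?Z" for z
    proof -
      obtain j where "j < n" "z = h (Inr j)"
        using z by auto
      then show ?thesis
        using edge[of "{Inl 0, Inr j}"] edge[of "{Inl 1, Inr j}"] by (auto simp: edges_book_set)
    qed
  qed simp
qed

section \<open>From missing books to wide colourings\<close>

lemma edges_complete_graph:
  "{x, y} \<in> edges (complete_graph n) \<longleftrightarrow> x < n \<and> y < n \<and> x \<noteq> y"
  by (auto simp: complete_graph_def pairs_def card_insert_if)

lemma gallai_coloring_pairs:
  fixes f :: "nat set \<Rightarrow> nat"
  assumes "gallai_coloring 3 (complete_graph n) f"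
  shows "symmetric_coloring.gallai (\<lambda>x y. f {x, y}) {..<n}"
proof -
  interpret symmetric_coloring "\<lambda>x y. f {x, y}"
    by unfold_locales (simp add: insert_commute)
  have "f {x, y} \<in> {1,2,3}" if "x < n" "y < n" "x \<noteq> y" for x y
  proof -
    have "f {x, y} \<in> {1..3}"
      using assms that edges_complete_graph unfolding gallai_coloring_def coloring_def by blast
    then show ?thesis
      by auto
  qed
  moreover have "f {x, y} = f {x, z} \<or> f {x, y} = f {y, z} \<or> f {x, z} = f {y, z}"
    if "x < n" "y < n" "z < n" "x \<noteq> y" "x \<noteq> z" "y \<noteq> z" for x y z
    using assms that unfolding gallai_coloring_def rainbow_triangle_def edges_complete_graph by blast
  ultimately show ?thesis
    unfolding gallai_def by auto
qed

text \<open>If fewer than \<open>n - m - 1\<close> vertices are joined to \<open>x\<close> or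
  \<open>y\<close> in \<open>e\<close>, at least \<open>m\<close> of the other \<open>n - 2\<close>
  can serve as pages. The resulting book, spine included, avoids \<open>e\<close> and so has at most
  two colours.\<close>

lemma wide_if_no_book:
  fixes f :: "nat set \<Rightarrow> nat"
  assumes f: "gallai_coloring 3 (complete_graph n) f"
    and no: "\<nexists>H. subgraph H (complete_graph n) \<and> isomorphic (book m) H \<and> card (f ` edges H) \<le> 2"
    and e: "e \<in> {1,2,3}"
  shows "symmetric_coloring.wide (\<lambda>x y. f {x, y}) {..<n} e (n - m - 1)"
proof -
  interpret symmetric_coloring "\<lambda>x y. f {x, y}"
    by unfold_locales (simp add: insert_commute)
  have G: "gallai {..<n}"
    using gallai_coloring_pairs[OF f] .
  show ?thesis
    unfolding wide_def
  proof (intro ballI impI, rule ccontr)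
    fix x y
    assume xy: "x \<in> {..<n}" "y \<in> {..<n}" "x \<noteq> y" "f {x, y} \<noteq> e"
    let ?U = "nbrs {..<n} e x \<union> nbrs {..<n} e y"
    assume "\<not> n - m - 1 \<le> card ?U"
    moreover have "n - 2 - card ?U \<le> card ({..<n} - {x, y} - ?U)"
      using diff_card_le_card_Diff[of ?U "{..<n} - {x, y}"] xy by simp
    ultimately have "m \<le> card ({..<n} - {x, y} - ?U)"
      by linarith
    then obtain Z where Z: "Z \<subseteq> {..<n} - {x, y} - ?U" "card Z = m"
      using obtain_subset_with_card_n by metis
    then have fin: "finite Z" and nxy: "x \<notin> Z" "y \<notin> Z" and ZV: "Z \<subseteq> {..<n}"
      using finite_subset[OF Z(1)] by auto
    define H where "H = \<lparr>verts = insert x (insert y Z),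
      edges = insert {x, y} ((\<lambda>z. {x, z}) ` Z \<union> (\<lambda>z. {y, z}) ` Z)\<rparr>"
    have "isomorphic (book m) H"
      using isomorphic_bookI[OF xy(3) nxy fin Z(2), of H] by (simp add: H_def)
    moreover have "subgraph H (complete_graph n)"
      using xy(1-3) nxy ZV
      by (auto simp: subgraph_def H_def simple_graph_def complete_graph_def pairs_def card_insert_if)
    moreover have "card (f ` edges H) \<le> 2"
    proof -
      have ne: "f {u, z} \<in> {1,2,3} - {e}" if "u = x \<or> u = y" "z \<in> Z" for u z
      proof -
        have "u \<noteq> z" "u \<in> {..<n}" "z \<in> {..<n}"
          using that nxy xy ZV by auto
        then show ?thesis
          using gallai_color[OF G, of u z] Z(1) that by (auto simp: nbrs_def)
      qed
      have "f ` edges H \<subseteq> {1,2,3} - {e}"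
        using ne xy(4) gallai_color[OF G xy(1-3)] by (auto simp: H_def)
      then have "card (f ` edges H) \<le> card ({1,2,3} - {e})"
        by (intro card_mono) auto
      also have "\<dots> = 2"
        using e by auto
      finally show ?thesis .
    qed
    ultimately show False
      using no by blast
  qed
qed

lemma gallai_coloring_22_book:
  fixes f :: "nat set \<Rightarrow> nat"
  assumes "gallai_coloring 3 (complete_graph 22) f"
  shows "\<exists>H. subgraph H (complete_graph 22) \<and> isomorphic (book 13) H \<and> card (f ` edges H) \<le> 2"
proof (rule ccontr)
  assume no: "\<not> ?thesis"
  interpret symmetric_coloring "\<lambda>x y. f {x, y}"
    by unfold_locales (simp add: insert_commute)
  show False
    using no_wide_coloring_22[OF gallai_coloring_pairs[OF assms]] wide_if_no_book[OF assms no] by simp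
qed

section \<open>The lower bound: a blown-up pentagon\<close>

text \<open>A vertex 20 joined in colour 1 to the pentagon whose five vertices are blown up to copies of
  \<open>K\<^sub>4\<close> in colour 1; colours 2 and 3 are the sides and the diagonals of the pentagon.\<close>

definition pentagon_color :: "nat \<Rightarrow> nat \<Rightarrow> nat" where
  "pentagon_color x y =
    (if x = 20 \<or> y = 20 \<or> x mod 5 = y mod 5 then 1
     else if (x + 1) mod 5 = y mod 5 \<or> (y + 1) mod 5 = x mod 5 then 2 else 3)"

text \<open>\<open>Min\<close> and \<open>Max\<close> recover the two ends of an edge; their order
  is harmless as \<open>pentagon_color\<close> is symmetric.\<close>

definition pentagon_coloring :: "nat set \<Rightarrow> nat" where
  "pentagon_coloring e = pentagon_color (Min e) (Max e)"

lemma pentagon_color_sym: "pentagon_color x y = pentagon_color y x"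
  by (auto simp: pentagon_color_def)

lemma pentagon_coloring_pair: "pentagon_coloring {x, y} = pentagon_color x y"
  by (simp add: pentagon_coloring_def min_def max_def pentagon_color_sym)

lemma pentagon_color_range: "pentagon_color x y \<in> {1,2,3}"
  by (simp add: pentagon_color_def)

lemma pentagon_color_20 [simp]: "pentagon_color 20 x = 1" "pentagon_color x 20 = 1"
  by (simp_all add: pentagon_color_def)

text \<open>The residue modulo 5 decides all colours at a vertex, except that 20 has residue 0
  without belonging to that class.\<close>

lemma pentagon_color_cong:
  assumes "x mod 5 = x' mod 5" "x = 20 \<longleftrightarrow> x' = 20"
  shows "pentagon_color x y = pentagon_color x' y"
proof -
  have "(x + 1) mod 5 = (x' + 1) mod 5"
    using assms(1) by (rule mod_add_cong) simp
  then show ?thesis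
    using assms unfolding pentagon_color_def by simp
qed

text \<open>The count depends only on \<open>x mod 5\<close>, and the five residues are evaluated.
  The class of \<open>x\<close>, with \<open>x\<close> itself, has 4 vertices; sides and diagonals
  each lead to two classes.\<close>

lemma pentagon_class:
  assumes "x < 20" "e \<in> {1,2,3}"
  shows "card {z. z < 20 \<and> pentagon_color x z = e} = (if e = 1 then 4 else 8)"
proof -
  have "{z. z < 20 \<and> pentagon_color x z = e} = {z. z < 20 \<and> pentagon_color (x mod 5) z = e}"
    using pentagon_color_cong[of x "x mod 5"] assms(1) mod_less_divisor[of 5 x] by auto
  also have "card \<dots> = length (filter (\<lambda>z. pentagon_color (x mod 5) z = e) [0..<20])"
    by (simp add: length_filter_conv_card cong: conj_cong)
  also have "list_all (\<lambda>r. list_all (\<lambda>e. length (filter (\<lambda>z. pentagon_color r z = e) [0..<20]) =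
      (if e = 1 then 4 else 8)) [1,2,3]) [0..<5]"
    by (simp add: pentagon_color_def upt_rec)
  then have "length (filter (\<lambda>z. pentagon_color (x mod 5) z = e) [0..<20]) = (if e = 1 then 4 else 8)"
    using assms(2) mod_less_divisor[of 5 x] unfolding list_all_iff by (simp only: set_upt) auto
  finally show ?thesis .
qed

lemma pentagon_color_1: "x < 20 \<Longrightarrow> y < 20 \<Longrightarrow> pentagon_color x y = 1 \<longleftrightarrow> x mod 5 = y mod 5"
  by (simp add: pentagon_color_def)

text \<open>At vertex 20 two edges share colour 1, and two vertices of one class look alike from the
  third vertex. Three vertices in distinct classes see only colours 2 and 3.\<close>

lemma pentagon_gallai: "n \<le> 21 \<Longrightarrow> gallai_coloring 3 (complete_graph n) pentagon_coloring"
proof -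
  have "pentagon_coloring e \<in> {1..3}" for e
    using pentagon_color_range[of "Min e" "Max e"] by (auto simp: pentagon_coloring_def)
  moreover have "pentagon_color x y = pentagon_color x z \<or> pentagon_color x y = pentagon_color y z \<or>
      pentagon_color x z = pentagon_color y z" for x y z
  proof (cases "x = 20 \<or> y = 20 \<or> z = 20")
    case True
    then show ?thesis
      by auto
  next
    case False
    show ?thesis
    proof (cases "x mod 5 = y mod 5 \<or> x mod 5 = z mod 5 \<or> y mod 5 = z mod 5")
      case True
      then show ?thesis
        using False pentagon_color_cong[of x y z] pentagon_color_cong[of x z y]
          pentagon_color_cong[of y z x] pentagon_color_sym by metis
    next
      case False': False
      have "pentagon_color u w = 2 \<or> pentagon_color u w = 3"
        if "u \<noteq> 20" "w \<noteq> 20" "u mod 5 \<noteq> w mod 5" for u w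
        using that by (simp add: pentagon_color_def)
      then show ?thesis
        using False False' by metis
    qed
  qed
  ultimately show ?thesis
    unfolding gallai_coloring_def coloring_def rainbow_triangle_def pentagon_coloring_pair by blast
qed

text \<open>This is wideness with 21 - 13 - 1 = 7. For colour 1, \<open>x\<close> and
  \<open>y\<close> lie in different classes, each with 3 further members, and vertex 20 is the
  seventh. For another colour, an end other than 20 already has 8 neighbours.\<close>

lemma pentagon_wide:
  assumes xy: "x < 21" "y < 21" "x \<noteq> y" "pentagon_color x y \<noteq> e" and e: "e \<in> {1,2,3}"
  shows "7 \<le> card {z. z < 21 \<and> z \<noteq> x \<and> z \<noteq> y \<and> (pentagon_color x z = e \<or> pentagon_color y z = e)}"
    (is "7 \<le> card ?S")
proof (cases "e = 1")
  case True
  let ?K = "\<lambda>x. {z. z < 20 \<and> pentagon_color x z = 1}"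
  have "x \<noteq> 20" "y \<noteq> 20" "x mod 5 \<noteq> y mod 5"
    using xy(4) True by (auto simp: pentagon_color_def)
  then have l: "x < 20" "y < 20" "x mod 5 \<noteq> y mod 5"
    using xy(1,2) by linarith+
  define T where "T = ?K x - {x} \<union> (?K y - {y})"
  have T: "finite T" "20 \<notin> T"
    by (auto simp: T_def)
  have sub: "insert 20 T \<subseteq> ?S"
  proof
    fix z
    assume "z \<in> insert 20 T"
    then show "z \<in> ?S"
      using l True pentagon_color_1[of x z] pentagon_color_1[of y z] by (auto simp: T_def)
  qed
  have "card (?K u - {u}) = 3" if "u < 20" for u
    using pentagon_class[OF that, of 1] that pentagon_color_1[of u u] by simp
  moreover have "(?K x - {x}) \<inter> (?K y - {y}) = {}"
    using l pentagon_color_1[of x] pentagon_color_1[of y] by auto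
  ultimately have "card T = 6"
    using l unfolding T_def by (subst card_Un_disjoint) simp_all
  then have "card (insert 20 T) = 7"
    using T by simp
  moreover have "card (insert 20 T) \<le> card ?S"
    using sub by (intro card_mono) simp_all
  ultimately show ?thesis
    by linarith
next
  case False
  then have e': "e \<in> {2, 3}"
    using e by auto
  have "x < 20 \<or> y < 20"
    using xy(1-3) by arith
  then obtain u where u: "u = x \<or> u = y" "u < 20"
    by blast
  have "{z. z < 20 \<and> pentagon_color u z = e} \<subseteq> ?S"
  proof
    fix z
    assume z: "z \<in> {z. z < 20 \<and> pentagon_color u z = e}"
    then have "z \<noteq> u"
      using u(2) e' pentagon_color_1[of u u] by auto
    moreover have "z \<noteq> x" "z \<noteq> y"
      using z u(1) \<open>z \<noteq> u\<close> xy(4) pentagon_color_sym[of x y] by auto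
    ultimately show "z \<in> ?S"
      using z u(1) by auto
  qed
  then have "card {z. z < 20 \<and> pentagon_color u z = e} \<le> card ?S"
    by (intro card_mono) simp_all
  then show ?thesis
    using pentagon_class[OF u(2) e] False by simp
qed

text \<open>For a colour \<open>e\<close> not on the spine, 13 pages and at least 7 vertices joined
  to the spine in \<open>e\<close> lie among 19 vertices, so they overlap. Thus all three colours
  occur in the book.\<close>

lemma pentagon_no_book:
  assumes n: "n \<le> 21" and H: "subgraph H (complete_graph n)" "isomorphic (book 13) H"
  shows "2 < card (pentagon_coloring ` edges H)"
proof -
  obtain x y Z where xyZ: "x \<in> verts H" "y \<in> verts H" "x \<noteq> y" "Z \<subseteq> verts H - {x, y}"
    "finite Z" "card Z = 13" "{x, y} \<in> edges H"
    "\<And>z. z \<in> Z \<Longrightarrow> {x, z} \<in> edges H \<and> {y, z} \<in> edges H"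
    using isomorphic_bookD[OF H(2)] by metis
  have V: "verts H \<subseteq> {..<21}" and "edges H \<subseteq> pairs {..<n}"
    using H(1) n by (auto simp: subgraph_def complete_graph_def)
  have "finite (edges H)"
    using finite_subset[OF \<open>edges H \<subseteq> pairs {..<n}\<close>] by (simp add: pairs_def)
  have "e \<in> pentagon_coloring ` edges H" if e: "e \<in> {1,2,3}" for e
  proof (cases "pentagon_color x y = e")
    case True
    then show ?thesis
      using xyZ(7) pentagon_coloring_pair by (metis image_eqI)
  next
    case False
    let ?S = "{z. z < 21 \<and> z \<noteq> x \<and> z \<noteq> y \<and> (pentagon_color x z = e \<or> pentagon_color y z = e)}"
    have "7 \<le> card ?S"
      using pentagon_wide[OF _ _ xyZ(3) False e] V xyZ(1,2) by auto
    moreover have "card (?S \<union> Z) \<le> card ({..<21} - {x, y})"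
      using V xyZ(4) by (intro card_mono) auto
    moreover have "card ({..<21} - {x, y}) = 19"
      using V xyZ(1-3) by (subst card_Diff_subset) auto
    ultimately have "?S \<inter> Z \<noteq> {}"
      using card_Un_disjoint[of ?S Z] xyZ(5,6) by auto
    then obtain z where "z \<in> Z" "pentagon_color x z = e \<or> pentagon_color y z = e"
      by blast
    then show ?thesis
      using xyZ(8) pentagon_coloring_pair by (metis image_eqI)
  qed
  then have "card {1, 2, 3 :: nat} \<le> card (pentagon_coloring ` edges H)"
    using \<open>finite (edges H)\<close> by (intro card_mono) auto
  then show ?thesis
    by simp
qed

theorem theorem4p9: "gr 3 2 (book 13) = 22"
  unfolding gr_def
proof (rule Least_equality)
  show "\<forall>f. gallai_coloring 3 (complete_graph 22) f \<longrightarrow>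
      (\<exists>H. subgraph H (complete_graph 22) \<and> isomorphic (book 13) H \<and> card (f ` edges H) \<le> 2)"
    using gallai_coloring_22_book by blast
  \<comment> \<open>The colouring on 21 vertices restricts to every smaller complete graph, so each
    \<open>p\<close> below 22 fails.\<close>
  show "22 \<le> p"
    if "\<forall>f. gallai_coloring 3 (complete_graph p) f \<longrightarrow>
      (\<exists>H. subgraph H (complete_graph p) \<and> isomorphic (book 13) H \<and> card (f ` edges H) \<le> 2)" for p
  proof (rule ccontr)
    assume "\<not> 22 \<le> p"
    then have "p \<le> 21"
      by simp
    then show False
      using that pentagon_gallai[OF \<open>p \<le> 21\<close>] pentagon_no_book[OF \<open>p \<le> 21\<close>] by (meson not_le)
  qed
qed

end
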